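(* Let $c,k$ be positive integers with $k$ odd, let $d,l,z$ be nonnegative integers, let $P(x)\in\mathbb{Z}[x]$, and let $0\le j<c$. If $n$ is an integer with $n\ge(\deg(P)+2(l+d)+1)kc$, then $$\sum_{\substack{0\le m\le n\\ m\equiv j \pmod{c}}}(-1)^{\frac{m-j}{c}} P(m)\,(q^z)^m\,\frac{d^l}{dq^l}\left[\binom{n}{m}_q\right]\equiv 0\pmod{\Phi_{kc}(q)^{d+1}}.$$
   Context: For integers $0\le m\le n$, $\binom{n}{m}_q=\frac{(1-q^n)\cdots(1-q^{n-m+1})}{(1-q^m)\cdots(1-q)}\in\mathbb{Z}[q]$ is the $q$-binomial coefficient. $\Phi_N(q)$ is the $N$-th cyclotomic polynomial, and $\frac{d^l}{dq^l}$ is the $l$-th derivative in $q$. The congruence means divisibility in $\mathbb{Z}[q]$. *)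

theory Defs
  imports Complex_Main "HOL-Computational_Algebra.Polynomial" "HOL-Number_Theory.Cong"
begin

(* The division is exact, see qbinom_mult_denom; for m > n the numerator is 0. *)
definition qbinom :: "nat \<Rightarrow> nat \<Rightarrow> int poly" where
  "qbinom n m = (\<Prod>i<m. 1 - monom 1 (n - i)) div (\<Prod>i=1..m. 1 - monom 1 i)"

definition primitive_roots_unity :: "nat \<Rightarrow> complex set" where
  "primitive_roots_unity N = {z. z ^ N = 1 \<and> (\<forall>d. 0 < d \<and> d < N \<longrightarrow> z ^ d \<noteq> 1)}"

(* Well defined for N > 0, see of_int_cyclotomic. *)
definition cyclotomic :: "nat \<Rightarrow> int poly" where
  "cyclotomic N =
     (THE p. map_poly of_int p = (\<Prod>z\<in>primitive_roots_unity N. [:- z, 1:]))"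

lemma qbinom_denom_dvd:
  "(\<Prod>i=1..m. 1 - monom 1 i) dvd (\<Prod>i<m. 1 - monom (1::int) (n - i))"
proof (induction n arbitrary: m)
  case 0
  show ?case
  proof (cases m)
    case (Suc k)
    have "(\<Prod>i<m. 1 - monom (1::int) (0 - i)) = 0"
      using Suc by (intro prod_zero) (auto simp: monom_0 one_pCons intro!: bexI[of _ 0])
    then show ?thesis by (simp only: dvd_0_right)
  qed simp
next
  case (Suc n)
  show ?case
  proof (cases m)
    case m: (Suc k)
    let ?D = "\<lambda>m. \<Prod>i=1..m. 1 - monom (1::int) i"
    let ?P = "\<lambda>n m. \<Prod>i<m. 1 - monom (1::int) (n - i)"
    have top: "?P (Suc n) m = (1 - monom 1 (Suc n)) * ?P n k"
      unfolding m by (subst prod.lessThan_Suc_shift) simp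
    have "?D (Suc k) dvd ?P (Suc n) m"
    proof (cases "k \<le> n")
      case True
      have split: "(1 - monom (1::int) (Suc n)) =
          (1 - monom 1 (Suc k)) + monom 1 (Suc k) * (1 - monom 1 (n - k))"
        using True by (simp add: algebra_simps mult_monom)
      have "?P (Suc n) m = (1 - monom 1 (Suc k)) * ?P n k + monom 1 (Suc k) * ?P n (Suc k)"
        unfolding top split by (simp add: algebra_simps)
      moreover have "?D (Suc k) dvd (1 - monom 1 (Suc k)) * ?P n k"
        using mult_dvd_mono[OF dvd_refl Suc.IH[of k], of "1 - monom 1 (Suc k)"]
        by (simp add: mult.commute)
      moreover have "?D (Suc k) dvd monom 1 (Suc k) * ?P n (Suc k)"
        by (rule dvd_mult[OF Suc.IH])
      ultimately show ?thesis by (simp only: dvd_add)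
    next
      case False
      then have "?P n k = 0"
        by (intro prod_zero) (auto simp: monom_0 one_pCons intro!: bexI[of _ n])
      then show ?thesis unfolding top by (simp only: mult_zero_right dvd_0_right)
    qed
    then show ?thesis unfolding m .
  qed simp
qed

lemma qbinom_mult_denom:
  "qbinom n m * (\<Prod>i=1..m. 1 - monom 1 i) = (\<Prod>i<m. 1 - monom 1 (n - i))"
  unfolding qbinom_def using qbinom_denom_dvd by simp

lemma map_poly_of_int_mult:
  "map_poly of_int (p * q) = (map_poly of_int p * map_poly of_int q :: complex poly)"
  by (rule poly_eqI) (simp add: coeff_map_poly coeff_mult)

lemma map_poly_of_int_add:
  "map_poly of_int (p + q) = (map_poly of_int p + map_poly of_int q :: complex poly)"
  by (rule poly_eqI) (simp add: coeff_map_poly)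

lemma map_poly_of_int_prod:
  "map_poly of_int (prod f A) = (\<Prod>x\<in>A. map_poly of_int (f x) :: complex poly)"
  by (induction A rule: infinite_finite_induct) (simp_all add: map_poly_of_int_mult)

lemma map_poly_of_int_inject:
  "(map_poly of_int p :: complex poly) = map_poly of_int q \<Longrightarrow> p = q"
  by (rule poly_eqI) (metis coeff_map_poly of_int_0 of_int_eq_iff)

lemma degree_map_poly_of_int: "degree (map_poly of_int p :: complex poly) = degree p"
  by (cases "p = 0") (simp_all add: map_poly_degree_eq)

lemma finite_unity_roots: "N > 0 \<Longrightarrow> finite {z::complex. z ^ N = 1}"
  using card_roots_unity_eq[of N] card.infinite by fastforce

lemma prod_unity_roots:
  assumes "N > 0"
  shows "(\<Prod>z | z ^ N = 1. [:- z, 1:]) = (monom 1 N - 1 :: complex poly)"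
proof (rule poly_eqI_degree_lead_coeff[where A = "{z. z ^ N = 1}" and n = N])
  let ?p = "\<Prod>z | z ^ N = 1. [:- z, 1 :: complex:]"
  have deg: "degree ?p = N"
    by (subst degree_prod_sum_eq) (auto simp: card_roots_unity_eq assms)
  then show "degree ?p \<le> N" by simp
  have "lead_coeff ?p = 1" by (subst lead_coeff_prod) simp
  then show "coeff ?p N = coeff (monom 1 N - 1) N" using deg assms by simp
  show "degree (monom 1 N - 1 :: complex poly) \<le> N"
    by (intro degree_diff_le) (auto simp: degree_monom_le)
  show "poly ?p z = poly (monom 1 N - 1) z" if "z \<in> {z. z ^ N = 1}" for z
    using that finite_unity_roots[OF assms]
    by (auto simp: poly_prod poly_monom intro!: prod_zero)
qed (simp add: card_roots_unity_eq assms)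

lemma unity_roots_eq_Union:
  assumes "N > 0"
  shows "{z. z ^ N = 1} = (\<Union>d\<in>{d. d dvd N}. primitive_roots_unity d)"
proof (intro equalityI subsetI)
  fix z :: complex assume z: "z \<in> {z. z ^ N = 1}"
  define d where "d = (LEAST d. 0 < d \<and> z ^ d = 1)"
  have d: "0 < d \<and> z ^ d = 1"
    unfolding d_def by (rule LeastI[of _ N]) (use z assms in auto)
  have least: "z ^ e \<noteq> 1" if "0 < e" "e < d" for e
    using not_less_Least[of e "\<lambda>d. 0 < d \<and> z ^ d = 1"] that unfolding d_def by auto
  have "z ^ N = z ^ (d * (N div d) + N mod d)" by simp
  also have "\<dots> = z ^ (N mod d)" using d by (simp only: power_add power_mult) simp
  finally have "z ^ (N mod d) = 1" using z by simp
  then have "d dvd N" using least[of "N mod d"] d by (auto simp: dvd_eq_mod_eq_0)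
  moreover have "z \<in> primitive_roots_unity d"
    using d least by (auto simp: primitive_roots_unity_def)
  ultimately show "z \<in> (\<Union>d\<in>{d. d dvd N}. primitive_roots_unity d)" by blast
qed (auto simp: primitive_roots_unity_def power_mult elim!: dvdE)

lemma primitive_roots_unity_disjoint:
  assumes "d > 0" "e > 0" "d \<noteq> e"
  shows "primitive_roots_unity d \<inter> primitive_roots_unity e = {}"
  using assms by (auto simp: primitive_roots_unity_def) (metis nat_neq_iff)

lemma prod_primitive_roots_dvd:
  assumes "N > 0"
  shows "(\<Prod>d | d dvd N. \<Prod>z\<in>primitive_roots_unity d. [:- z, 1:]) = monom 1 N - 1"
proof -
  have pos: "d > 0" if "d dvd N" for d using that assms by (auto intro: Nat.gr0I)
  have "finite (primitive_roots_unity d)" if "d dvd N" for d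
    by (rule finite_subset[OF _ finite_unity_roots[OF pos[OF that]]])
       (auto simp: primitive_roots_unity_def)
  then show ?thesis
    unfolding prod_unity_roots[OF assms, symmetric] unity_roots_eq_Union[OF assms]
    using assms primitive_roots_unity_disjoint pos
    by (subst prod.UNION_disjoint) auto
qed

lemma ex_int_cyclotomic:
  "N > 0 \<Longrightarrow> \<exists>p. map_poly of_int p = (\<Prod>z\<in>primitive_roots_unity N. [:- z, 1:])"
proof (induction N rule: less_induct)
  case (less N)
  let ?F = "\<lambda>d. \<Prod>z\<in>primitive_roots_unity d. [:- z, 1:]"
  let ?D = "{d. d dvd N} - {N}"
  have "\<exists>p. map_poly of_int p = ?F d" if "d \<in> ?D" for d
    using that less.prems by (intro less.IH) (auto intro: Nat.gr0I dest: dvd_imp_le)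
  then obtain f where f: "\<And>d. d \<in> ?D \<Longrightarrow> map_poly of_int (f d) = ?F d" by metis
  define B where "B = prod f ?D"
  have B: "map_poly of_int B = prod ?F ?D"
    unfolding B_def map_poly_of_int_prod by (rule prod.cong) (auto simp: f)
  have "lead_coeff (map_poly of_int B :: complex poly) = 1"
    unfolding B by (simp add: lead_coeff_prod)
  then have monic: "lead_coeff B = 1"
    by (simp add: degree_map_poly_of_int coeff_map_poly)
  then have "B \<noteq> 0" by auto
  obtain q r where qr: "pseudo_divmod (monom 1 N - 1) B = (q, r)" by fastforce
  have eq: "monom 1 N - 1 = B * q + r" and r: "r = 0 \<or> degree r < degree B"
    using pseudo_divmod[OF \<open>B \<noteq> 0\<close> qr] monic by simp_all
  have "map_poly of_int (monom 1 N - 1) = (monom 1 N - 1 :: complex poly)"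
    by (rule poly_eqI) (simp add: coeff_map_poly one_pCons coeff_pCons split: nat.split)
  also have "\<dots> = ?F N * map_poly of_int B"
    unfolding prod_primitive_roots_dvd[OF less.prems, symmetric] B
    using less.prems by (intro prod.remove) auto
  finally have "map_poly of_int B * map_poly of_int q + map_poly of_int r =
      ?F N * map_poly of_int B"
    unfolding eq map_poly_of_int_add map_poly_of_int_mult .
  then have rB: "map_poly of_int r = (?F N - map_poly of_int q) * map_poly of_int B"
    by (simp add: algebra_simps)
  have "?F N - map_poly of_int q = 0"
  proof (rule ccontr)
    assume nz: "?F N - map_poly of_int q \<noteq> 0"
    have Bnz: "(map_poly of_int B :: complex poly) \<noteq> 0"
      using \<open>B \<noteq> 0\<close> map_poly_of_int_inject[of B 0] by auto
    from rB nz Bnz have "r \<noteq> 0" by auto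
    moreover have "degree B \<le> degree r"
      using arg_cong[OF rB, of degree] degree_mult_eq[OF nz Bnz]
      by (simp add: degree_map_poly_of_int)
    ultimately show False using r by simp
  qed
  then show ?case by (intro exI[of _ q]) simp
qed

lemma of_int_cyclotomic:
  assumes "N > 0"
  shows "map_poly of_int (cyclotomic N) = (\<Prod>z\<in>primitive_roots_unity N. [:- z, 1:])"
proof -
  have "\<exists>!p. map_poly of_int p = (\<Prod>z\<in>primitive_roots_unity N. [:- z, 1:])"
    using ex_int_cyclotomic[OF assms] map_poly_of_int_inject by metis
  then show ?thesis unfolding cyclotomic_def by (rule theI')
qed

end

theory Submission
  imports Defs "HOL-Computational_Algebra.Polynomial_Factorial"
    "HOL-Computational_Algebra.Field_as_Ring"
begin

text \<open>
  Let \<open>N = kc\<close> and let \<open>\<psi>\<close> be any function with \<open>\<psi> (m + N) = - \<psi> m\<close>; since \<open>k\<close> is odd, the signs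
  of the theorem, extended by zero to all residues mod \<open>c\<close>, form such a function. Fix a primitive
  \<open>N\<close>-th root of unity \<open>w\<close> and let \<open>P\<close> have complex coefficients. The claim is that
  \<open>\<Sum>m. \<psi> m P(m) q^(zm) binom(n,m)_q\<close> is divisible by \<open>(q - w)^e\<close> as soon as
  \<open>n \<ge> aN\<close> and \<open>deg P + 2e \<le> a + 1\<close>, by induction on \<open>a\<close>. The \<open>q\<close>-Vandermonde identity writes the
  sum for \<open>n + N\<close> as a combination, with coefficients \<open>binom(N,j)_q\<close>, of sums for \<open>n\<close>. For
  \<open>0 < j < N\<close> the coefficient is divisible by \<open>q - w\<close>. The terms \<open>j = 0\<close> and \<open>j = N\<close> combine, up to
  multiples of \<open>q - w\<close>, to the sum with \<open>P(m) - P(m + N)\<close>, of smaller degree, and the sum with the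
  factor \<open>q^(Nm) - 1 = \<Sum>r\<ge>1. (m choose r) (q^N - 1)^r\<close>, whose \<open>r\<close>-th term gains \<open>(q - w)^r\<close>
  while the degree grows by only \<open>r\<close>.

  Each derivative of the binomial coefficient is traded by the product rule for one derivative of
  the whole sum or one factor \<open>m\<close>.
\<close>

section \<open>q-binomial coefficients over the integers and over the complex numbers\<close>

lemma qbinom_denom_nonzero: "(\<Prod>i=1..m. 1 - monom (1::int) i) \<noteq> 0"
proof -
  have "1 - monom (1::int) i \<noteq> 0" if "i \<ge> 1" for i
    using that degree_monom_eq[of "1::int" i] by (auto dest: sym)
  then show ?thesis by (auto simp: prod_zero_iff)
qed

lemma qbinom_0 [simp]: "qbinom n 0 = 1"
  by (simp add: qbinom_def)

lemma qbinom_eq_0: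
  assumes "n < m"
  shows "qbinom n m = 0"
proof -
  have "(\<Prod>i<m. 1 - monom (1::int) (n - i)) = 0"
    using assms by (intro prod_zero) (auto simp: monom_0 one_pCons intro!: bexI[of _ n])
  then show ?thesis by (simp only: qbinom_def div_0)
qed

lemma qbinom_self [simp]: "qbinom n n = 1"
proof -
  have "(\<Prod>i<n. 1 - monom (1::int) (n - i)) = (\<Prod>i=1..n. 1 - monom 1 i)"
    by (rule prod.reindex_bij_witness[of _ "\<lambda>i. n - i" "\<lambda>i. n - i"]) auto
  then show ?thesis
    unfolding qbinom_def by (simp only: div_self[OF qbinom_denom_nonzero])
qed

text \<open>The q-Pascal rule: after clearing the nonzero denominator it is the splitting 1 -
  q^(n+1) = (1 - q^(m+1)) + q^(m+1) (1 - q^(n-m)).\<close>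

lemma qbinom_Suc_Suc:
  "qbinom (Suc n) (Suc m) = qbinom n m + monom 1 (Suc m) * qbinom n (Suc m)"
proof (cases "m \<le> n")
  case True
  let ?D = "\<lambda>m. \<Prod>i=1..m. 1 - monom (1::int) i"
  let ?P = "\<lambda>n m. \<Prod>i<m. 1 - monom (1::int) (n - i)"
  have D: "?D (Suc m) = ?D m * (1 - monom 1 (Suc m))" by simp
  have top: "?P (Suc n) (Suc m) = (1 - monom 1 (Suc n)) * ?P n m"
    by (subst prod.lessThan_Suc_shift) simp
  have split: "(1 - monom (1::int) (Suc n)) =
      (1 - monom 1 (Suc m)) + monom 1 (Suc m) * (1 - monom 1 (n - m))"
    using True by (simp add: algebra_simps mult_monom)
  have "qbinom (Suc n) (Suc m) * ?D (Suc m) = ?P (Suc n) (Suc m)"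
    by (rule qbinom_mult_denom)
  also have "\<dots> = (1 - monom 1 (Suc m)) * ?P n m + monom 1 (Suc m) * ?P n (Suc m)"
    unfolding top split by (simp add: algebra_simps)
  also have "\<dots> = (1 - monom 1 (Suc m)) * (qbinom n m * ?D m)
      + monom 1 (Suc m) * (qbinom n (Suc m) * ?D (Suc m))"
    unfolding qbinom_mult_denom ..
  also have "\<dots> = (qbinom n m + monom 1 (Suc m) * qbinom n (Suc m)) * ?D (Suc m)"
    unfolding D by (simp only: algebra_simps)
  finally show ?thesis using qbinom_denom_nonzero[of "Suc m"] mult_right_cancel by blast
qed (simp add: qbinom_eq_0)

definition cqbinom :: "nat \<Rightarrow> nat \<Rightarrow> complex poly" where
  "cqbinom n m = map_poly of_int (qbinom n m)"

lemma map_poly_of_int_monom: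
  "map_poly of_int (monom a n) = (monom (of_int a) n :: complex poly)"
  by (simp add: map_poly_monom)

lemma cqbinom_0 [simp]: "cqbinom n 0 = 1"
  and cqbinom_self [simp]: "cqbinom n n = 1"
  and cqbinom_eq_0: "n < m \<Longrightarrow> cqbinom n m = 0"
  by (simp_all add: cqbinom_def qbinom_eq_0)

lemma cqbinom_Suc_Suc:
  "cqbinom (Suc n) (Suc m) = cqbinom n m + monom 1 (Suc m) * cqbinom n (Suc m)"
  by (simp add: cqbinom_def qbinom_Suc_Suc map_poly_of_int_add map_poly_of_int_mult
      map_poly_of_int_monom)

text \<open>The numerator contains 1 - q^N, which vanishes at \<open>w\<close>; the denominator has
  only factors 1 - q^i with 0 < i < N, which do not.\<close>

lemma poly_cqbinom_primitive_root:
  assumes "w \<in> primitive_roots_unity N" "0 < j" "j < N"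
  shows "poly (cqbinom N j) w = 0"
proof -
  have one: "poly (map_poly of_int (1 - monom 1 i)) w = 1 - w ^ i" for i
  proof -
    have "map_poly of_int (1 - monom 1 i) = (1 - monom 1 i :: complex poly)"
      by (rule poly_eqI) (simp add: coeff_map_poly one_pCons coeff_pCons split: nat.split)
    then show ?thesis by (simp add: poly_monom)
  qed
  have "poly (map_poly of_int (qbinom N j * (\<Prod>i=1..j. 1 - monom 1 i))) w
      = poly (map_poly of_int (\<Prod>i<j. 1 - monom 1 (N - i))) w"
    by (simp only: qbinom_mult_denom)
  then have "poly (cqbinom N j) w * (\<Prod>i=1..j. 1 - w ^ i) = (\<Prod>i<j. 1 - w ^ (N - i))"
    by (simp only: map_poly_of_int_mult map_poly_of_int_prod poly_mult poly_prod one cqbinom_def)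
  also have "\<dots> = 0"
    using assms by (intro prod_zero) (auto simp: primitive_roots_unity_def intro!: bexI[of _ 0])
  finally show ?thesis
    using assms by (auto simp: primitive_roots_unity_def prod_zero_iff)
qed

section \<open>Sums weighted by q-binomials and the q-Vandermonde identity\<close>

definition qsum :: "nat \<Rightarrow> (nat \<Rightarrow> complex poly) \<Rightarrow> complex poly" where
  "qsum n f = (\<Sum>m\<le>n. f m * cqbinom n m)"

lemma qsum_cong: "(\<And>m. m \<le> n \<Longrightarrow> f m = g m) \<Longrightarrow> qsum n f = qsum n g"
  by (simp add: qsum_def)

lemma qsum_add: "qsum n (\<lambda>m. f m + g m) = qsum n f + qsum n g"
  by (simp add: qsum_def algebra_simps sum.distrib)

lemma qsum_mult_left: "qsum n (\<lambda>m. p * f m) = p * qsum n f"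
  by (simp add: qsum_def sum_distrib_left mult.assoc)

lemma qsum_sum: "qsum n (\<lambda>m. \<Sum>r\<in>A. f r m) = (\<Sum>r\<in>A. qsum n (f r))"
  unfolding qsum_def sum_distrib_right by (rule sum.swap)

lemma qsum_Suc:
  "qsum (Suc n) f = qsum n (\<lambda>m. f (Suc m)) + qsum n (\<lambda>m. monom 1 m * f m)"
proof -
  have "qsum (Suc n) f = f 0 + (\<Sum>m\<le>n. f (Suc m) * cqbinom (Suc n) (Suc m))"
    unfolding qsum_def by (subst sum.atMost_Suc_shift) simp
  also have "\<dots> = qsum n (\<lambda>m. f (Suc m))
      + (f 0 + (\<Sum>m\<le>n. monom 1 (Suc m) * f (Suc m) * cqbinom n (Suc m)))"
    by (simp add: qsum_def cqbinom_Suc_Suc algebra_simps sum.distrib)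
  also have "f 0 + (\<Sum>m\<le>n. monom 1 (Suc m) * f (Suc m) * cqbinom n (Suc m))
      = (\<Sum>m\<le>Suc n. monom 1 m * f m * cqbinom n m)"
    by (subst sum.atMost_Suc_shift) simp
  also have "\<dots> = qsum n (\<lambda>m. monom 1 m * f m)"
    by (simp add: qsum_def cqbinom_eq_0)
  finally show ?thesis .
qed

text \<open>The identity binom(n+N,m)_q = sum over j of q^((N-j)(m-j)) binom(N,j)_q binom(n,m-j)_q,
  paired with an arbitrary \<open>f\<close>; in this form it follows by iterating
  \<open>qsum_Suc\<close>.\<close>

lemma qsum_Vandermonde:
  "qsum (n + N) f = qsum N (\<lambda>j. qsum n (\<lambda>i. monom 1 ((N - j) * i) * f (i + j)))"
proof (induction N arbitrary: f)
  case 0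
  show ?case by (simp add: qsum_def[of 0] monom_0 flip: one_pCons)
next
  case (Suc N)
  have "qsum (n + Suc N) f
      = qsum N (\<lambda>j. qsum n (\<lambda>i. monom 1 ((N - j) * i) * f (Suc (i + j))))
      + qsum N (\<lambda>j. qsum n (\<lambda>i. monom 1 ((N - j) * i) * (monom 1 (i + j) * f (i + j))))"
    by (simp add: qsum_Suc Suc.IH)
  also have "qsum N (\<lambda>j. qsum n (\<lambda>i. monom 1 ((N - j) * i) * (monom 1 (i + j) * f (i + j))))
      = qsum N (\<lambda>j. monom 1 j * qsum n (\<lambda>i. monom 1 ((Suc N - j) * i) * f (i + j)))"
    unfolding qsum_mult_left[symmetric] mult.assoc[symmetric] mult_monom
    by (intro qsum_cong) (simp add: Suc_diff_le algebra_simps)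
  finally show ?case by (simp add: qsum_Suc)
qed

section \<open>Divisibility by powers of q - w, without derivatives\<close>

definition qterm :: "(nat \<Rightarrow> complex) \<Rightarrow> complex poly \<Rightarrow> nat \<Rightarrow> nat \<Rightarrow> complex poly" where
  "qterm \<psi> P z m = monom (\<psi> m * poly P (of_nat m)) (z * m)"

definition binom_poly :: "nat \<Rightarrow> complex poly" where
  "binom_poly r = smult (1 / fact r) (\<Prod>i<r. [:- of_nat i, 1:])"

lemma poly_binom_poly: "poly (binom_poly r) (of_nat m) = of_nat (m choose r)"
  by (simp add: binom_poly_def poly_prod binomial_gbinomial gbinomial_prod_rev atLeast0LessThan)

lemma degree_binom_poly: "degree (binom_poly r) \<le> r"
proof -
  have "degree (\<Prod>i<r. [:- of_nat i, 1 :: complex:]) \<le> r"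
    by (subst degree_prod_sum_eq) auto
  then show ?thesis unfolding binom_poly_def by (rule order_trans[OF degree_smult_le])
qed

text \<open>The upper limit \<open>n\<close> does not depend on \<open>i\<close>, so the sum over
  \<open>r\<close> can later be pulled out of a sum over \<open>i\<close>.\<close>

lemma power_eq_sum_binomial:
  fixes u :: "'a::comm_ring_1"
  assumes "i \<le> n"
  shows "(1 + u) ^ i - 1 = (\<Sum>r=1..n. of_nat (i choose r) * u ^ r)"
proof -
  have "(1 + u) ^ i = (\<Sum>r\<le>i. of_nat (i choose r) * u ^ r)"
    using binomial_ring[of u 1 i] by (simp add: add.commute)
  also have "\<dots> = (\<Sum>r\<le>n. of_nat (i choose r) * u ^ r)"
    using assms by (intro sum.mono_neutral_left) (auto simp: binomial_eq_0)
  also have "\<dots> = 1 + (\<Sum>r=1..n. of_nat (i choose r) * u ^ r)"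
    by (simp add: atMost_atLeast0 sum.atLeast_Suc_atMost)
  finally show ?thesis by simp
qed

text \<open>The leading coefficients cancel. The second alternative serves constant
  \<open>P\<close>, where the degree cannot drop.\<close>

lemma degree_pcompose_shift_diff:
  fixes P :: "complex poly"
  shows "degree (P - P \<circ>\<^sub>p [:a, 1:]) < degree P \<or> P - P \<circ>\<^sub>p [:a, 1:] = 0"
proof (cases "degree P = 0")
  case True
  then show ?thesis by (metis degree_eq_zeroE pcompose_const diff_self)
next
  case False
  have deg: "degree (P \<circ>\<^sub>p [:a, 1:]) = degree P" by (simp add: degree_pcompose)
  have "coeff (P \<circ>\<^sub>p [:a, 1:]) (degree P) = lead_coeff P"
    using lead_coeff_comp[of "[:a, 1:]" P] deg by simp
  then have "coeff (P - P \<circ>\<^sub>p [:a, 1:]) (degree P) = 0" by simp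
  moreover have "degree (P - P \<circ>\<^sub>p [:a, 1:]) \<le> degree P"
    by (rule degree_diff_le) (simp_all add: deg)
  ultimately show ?thesis using False
    by (metis leading_coeff_0_iff nat_less_le)
qed

lemma linear_dvd_monom_minus_1:
  assumes "(w::complex) ^ N = 1"
  shows "[:- w, 1:] dvd monom 1 (N * z) - 1"
  using assms by (simp add: poly_eq_0_iff_dvd[symmetric] poly_monom power_mult)

text \<open>The budget \<open>degree P + 2 * e\<close> may grow by one with each step in
  \<open>a\<close>, so every use of the induction hypothesis must save a unit: losing one power of q
  - w saves two, \<open>P - ?Q\<close> saves at least one, and the \<open>r\<close>-th binomial term
  saves 2r - r.\<close>

lemma linear_power_dvd_qsum:
  assumes "w \<in> primitive_roots_unity N" "N > 0"
    and "\<And>m. \<psi> (m + N) = - \<psi> m" "n \<ge> a * N" "degree P + 2 * e \<le> a + 1"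
  shows "[:- w, 1:] ^ e dvd qsum n (qterm \<psi> P z)"
  using assms(3-5)
proof (induction a arbitrary: n \<psi> P z e)
  case 0
  then have "e = 0" by simp
  then show ?case by simp
next
  case (Suc a n' \<psi> P z e')
  let ?L = "[:- w, 1:]"
  have wN: "w ^ N = 1" using assms(1) by (simp add: primitive_roots_unity_def)
  show ?case
  proof (cases e')
    case e: (Suc e)
    obtain n where n': "n' = n + N" and n: "n \<ge> a * N"
      using Suc.prems(2) le_Suc_ex[of "Suc a * N" n'] by (auto simp: algebra_simps intro: that)
    let ?f = "qterm \<psi> P z"
    let ?g = "\<lambda>j. qsum n (\<lambda>i. monom 1 ((N - j) * i) * ?f (i + j))"
    \<comment> \<open>The factor q^((N-j)i) is absorbed into the exponent \<open>z\<close>, and the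
      shift by \<open>j\<close> into \<open>\<psi>\<close> and \<open>P\<close>; hence all three
      vary in the induction.\<close>
    have shift: "?L ^ e dvd ?g j" if "j \<le> N" for j
    proof -
      have "monom 1 ((N - j) * i) * ?f (i + j)
          = monom 1 (z * j) * qterm (\<lambda>m. \<psi> (m + j)) (P \<circ>\<^sub>p [:of_nat j, 1:]) (z + (N - j)) i" for i
        by (simp add: qterm_def mult_monom poly_pcompose algebra_simps)
      then have "?g j = monom 1 (z * j) *
          qsum n (qterm (\<lambda>m. \<psi> (m + j)) (P \<circ>\<^sub>p [:of_nat j, 1:]) (z + (N - j)))"
        by (simp add: qsum_mult_left)
      moreover have "?L ^ e dvd qsum n (qterm (\<lambda>m. \<psi> (m + j)) (P \<circ>\<^sub>p [:of_nat j, 1:]) (z + (N - j)))"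
        using Suc.prems e Suc.prems(1)[of "_ + j"] n
        by (intro Suc.IH) (auto simp: algebra_simps degree_pcompose)
      ultimately show ?thesis by simp
    qed
    have middle: "?L ^ e' dvd ?g j * cqbinom N j" if "0 < j" "j < N" for j
    proof -
      have "?L dvd cqbinom N j"
        using poly_cqbinom_primitive_root[OF assms(1) that] by (simp add: poly_eq_0_iff_dvd)
      then show ?thesis using shift[of j] that unfolding e power_Suc2 by (intro mult_dvd_mono) auto
    qed
    let ?Q = "P \<circ>\<^sub>p [:of_nat N, 1:]"
    let ?u = "monom 1 N - 1 :: complex poly"
    \<comment> \<open>The sign change of \<open>\<psi>\<close> turns the sum of the two end terms
      into a difference.\<close>
    have f_shift: "?f (i + N) = - (monom 1 (N * z) * qterm \<psi> ?Q z i)" for i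
      unfolding qterm_def Suc.prems(1)
      by (simp add: mult_monom poly_pcompose algebra_simps minus_monom)
    have A: "?L ^ e' dvd qsum n (\<lambda>i. (monom 1 (N * i) - 1) * ?f i)"
    proof -
      have "(monom 1 (N * i) - 1) * ?f i
          = (\<Sum>r=1..n. ?u ^ r * qterm \<psi> (P * binom_poly r) z i)" if "i \<le> n" for i
      proof -
        have "monom 1 (N * i) - 1 = (1 + ?u) ^ i - (1 :: complex poly)"
          by (simp add: monom_power)
        also have "\<dots> = (\<Sum>r=1..n. of_nat (i choose r) * ?u ^ r)"
          using that by (rule power_eq_sum_binomial)
        finally have "(monom 1 (N * i) - 1) * ?f i
            = (\<Sum>r=1..n. of_nat (i choose r) * ?u ^ r * ?f i)"
          by (simp only: sum_distrib_right)
        also have "\<dots> = (\<Sum>r=1..n. ?u ^ r * qterm \<psi> (P * binom_poly r) z i)"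
        proof (rule sum.cong[OF refl])
          fix r
          have "qterm \<psi> (P * binom_poly r) z i = of_nat (i choose r) * ?f i"
            by (simp add: qterm_def poly_binom_poly smult_monom mult_ac of_nat_poly)
          then show "of_nat (i choose r) * ?u ^ r * ?f i
              = ?u ^ r * qterm \<psi> (P * binom_poly r) z i"
            by (simp only: mult_ac)
        qed
        finally show ?thesis .
      qed
      then have "qsum n (\<lambda>i. (monom 1 (N * i) - 1) * ?f i)
          = (\<Sum>r=1..n. ?u ^ r * qsum n (qterm \<psi> (P * binom_poly r) z))"
        by (simp add: qsum_sum qsum_mult_left cong: qsum_cong)
      also have "?L ^ e' dvd \<dots>"
      proof (rule dvd_sum)
        fix r assume r: "r \<in> {1..n}"
        have Lr: "?L ^ r dvd ?u ^ r"
          using linear_dvd_monom_minus_1[OF wN, of 1] by (simp add: dvd_power_same)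
        show "?L ^ e' dvd ?u ^ r * qsum n (qterm \<psi> (P * binom_poly r) z)"
        proof (cases "r \<le> e'")
          case True
          have "degree (P * binom_poly r) \<le> degree P + r"
            using degree_mult_le[of P "binom_poly r"] degree_binom_poly[of r] by linarith
          then have "?L ^ (e' - r) dvd qsum n (qterm \<psi> (P * binom_poly r) z)"
            using Suc.prems n r True by (intro Suc.IH) auto
          then have "?L ^ r * ?L ^ (e' - r) dvd ?u ^ r * qsum n (qterm \<psi> (P * binom_poly r) z)"
            by (rule mult_dvd_mono[OF Lr])
          then show ?thesis using True by (simp flip: power_add)
        next
          \<comment> \<open>Here \<open>?u ^ r\<close> alone supplies all the required
            factors.\<close>
          case False
          then have "?L ^ e' dvd ?L ^ r" by (intro le_imp_power_dvd) simp
          then show ?thesis using Lr by (meson dvd_mult2 dvd_trans)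
        qed
      qed
      finally show ?thesis .
    qed
    have B: "?L ^ e' dvd qsum n (qterm \<psi> (P - ?Q) z)"
      using degree_pcompose_shift_diff[of P "of_nat N"]
    proof
      assume "degree (P - ?Q) < degree P"
      then show ?thesis using Suc.prems n by (intro Suc.IH) auto
    qed (simp add: qterm_def qsum_def)
    have C: "?L ^ e' dvd - (monom 1 (N * z) - 1) * qsum n (qterm \<psi> ?Q z)"
    proof -
      have "?L ^ e dvd qsum n (qterm \<psi> ?Q z)"
        using Suc.prems e n by (intro Suc.IH) (auto simp: degree_pcompose)
      then show ?thesis
        unfolding e power_Suc
        using linear_dvd_monom_minus_1[OF wN, of z] by (intro mult_dvd_mono) (simp_all only: dvd_minus_iff)
    qed
    \<comment> \<open>With f' the term for \<open>?Q\<close>: q^(Ni) f - q^(Nz) f' = (q^(Ni) - 1) f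
      + (f - f') - (q^(Nz) - 1) f'.\<close>
    have "?g 0 + ?g N = qsum n (\<lambda>i. (monom 1 (N * i) - 1) * ?f i
        + (qterm \<psi> (P - ?Q) z i + - (monom 1 (N * z) - 1) * qterm \<psi> ?Q z i))"
    proof -
      have "qterm \<psi> (P - ?Q) z i = ?f i - qterm \<psi> ?Q z i" for i
        by (simp add: qterm_def algebra_simps diff_monom)
      then show ?thesis
        unfolding qsum_add[symmetric] f_shift
        by (intro qsum_cong) (simp add: algebra_simps monom_0 flip: one_pCons)
    qed
    then have ends: "?L ^ e' dvd ?g 0 + ?g N"
      unfolding qsum_add qsum_mult_left using A B C by (simp only: dvd_add)
    have "qsum n' ?f = (\<Sum>j\<le>N. ?g j * cqbinom N j)"
      unfolding n' qsum_Vandermonde by (simp only: qsum_def[of N])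
    also have "{..N} = insert 0 (insert N {0<..<N})" by auto
    also have "(\<Sum>j\<in>insert 0 (insert N {0<..<N}). ?g j * cqbinom N j)
        = (?g 0 + ?g N) + (\<Sum>j\<in>{0<..<N}. ?g j * cqbinom N j)"
      using assms(2) by (simp add: add.assoc)
    also have "?L ^ e' dvd \<dots>"
      using middle by (intro dvd_add[OF ends] dvd_sum) auto
    finally show ?thesis .
  qed simp
qed

section \<open>Derivatives of the q-binomial coefficients\<close>

definition qsum_deriv ::
    "nat \<Rightarrow> nat \<Rightarrow> (nat \<Rightarrow> complex) \<Rightarrow> complex poly \<Rightarrow> nat \<Rightarrow> complex poly" where
  "qsum_deriv n l \<psi> P z = (\<Sum>m\<le>n. qterm \<psi> P z m * (pderiv ^^ l) (cqbinom n m))"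

text \<open>The operator q d/dq multiplies q^(zm) by zm; the factor m goes into the polynomial as
  \<open>pCons 0 P\<close>. Multiplying by q avoids the exponent zm - 1.\<close>

lemma monom_mult_pderiv_qterm:
  "monom 1 1 * pderiv (qterm \<psi> P z m) = smult (of_nat z) (qterm \<psi> (pCons 0 P) z m)"
proof (cases "z * m = 0")
  case True
  then show ?thesis by (auto simp: qterm_def pderiv_monom)
next
  case False
  then show ?thesis by (simp add: qterm_def pderiv_monom mult_monom smult_monom mult_ac)
qed

lemma pderiv_sum_complex: "pderiv (\<Sum>x\<in>A. f x :: complex poly) = (\<Sum>x\<in>A. pderiv (f x))"
  by (induction A rule: infinite_finite_induct) (simp_all add: pderiv_add)

lemma smult_sum_right: "smult a (\<Sum>x\<in>A. f x) = (\<Sum>x\<in>A. smult a (f x))"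
  by (induction A rule: infinite_finite_induct) (simp_all add: smult_add_right)

lemma qsum_deriv_Suc:
  "monom 1 1 * qsum_deriv n (Suc l) \<psi> P z =
    monom 1 1 * pderiv (qsum_deriv n l \<psi> P z)
    - smult (of_nat z) (qsum_deriv n l \<psi> (pCons 0 P) z)"
proof -
  have "monom 1 1 * pderiv (qsum_deriv n l \<psi> P z) =
      (\<Sum>m\<le>n. (monom 1 1 * pderiv (qterm \<psi> P z m)) * (pderiv ^^ l) (cqbinom n m)
        + monom 1 1 * (qterm \<psi> P z m * (pderiv ^^ Suc l) (cqbinom n m)))"
    unfolding qsum_deriv_def pderiv_sum_complex pderiv_mult sum_distrib_left
    by (intro sum.cong refl) (simp add: algebra_simps)
  also have "\<dots> = smult (of_nat z) (qsum_deriv n l \<psi> (pCons 0 P) z)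
      + monom 1 1 * qsum_deriv n (Suc l) \<psi> P z"
    unfolding monom_mult_pderiv_qterm sum.distrib qsum_deriv_def
    by (simp add: sum_distrib_left smult_sum_right)
  finally show ?thesis by simp
qed

lemma power_dvd_pderiv:
  fixes L :: "complex poly"
  assumes "L ^ Suc e dvd p"
  shows "L ^ e dvd pderiv p"
proof -
  from assms obtain r where "p = L ^ Suc e * r" by (elim dvdE)
  then show ?thesis
    by (simp only: pderiv_mult pderiv_power_Suc) (simp add: mult.assoc dvd_add dvd_smult)
qed

lemma coprime_linear_polys:
  assumes "(a::complex) \<noteq> b"
  shows "coprime [:- a, 1:] [:- b, 1:]"
proof (rule coprimeI)
  fix p assume "p dvd [:- a, 1:]" "p dvd [:- b, 1:]"
  then have "p dvd [:- a, 1:] - [:- b, 1:]" by (rule dvd_diff)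
  then have "p dvd [:b - a:]" by simp
  moreover have "is_unit [:b - a:]" using assms by (simp add: is_unit_triv)
  ultimately show "is_unit p" by (rule dvd_unit_imp_unit)
qed

text \<open>Each derivative costs two units of the budget: differentiating the whole sum loses one
  power of q - w, while the extra factor m costs only one degree.\<close>

lemma linear_power_dvd_qsum_deriv:
  assumes "w \<in> primitive_roots_unity N" "N > 0"
    and "\<And>m. \<psi> (m + N) = - \<psi> m" "n \<ge> a * N" "degree P + 2 * l + 2 * e \<le> a + 1"
  shows "[:- w, 1:] ^ e dvd qsum_deriv n l \<psi> P z"
  using assms(5)
proof (induction l arbitrary: P e)
  case 0
  have "qsum_deriv n 0 \<psi> P z = qsum n (qterm \<psi> P z)"
    by (simp add: qsum_deriv_def qsum_def)
  then show ?case
    using linear_power_dvd_qsum[where \<psi> = \<psi>, OF assms(1-4)] 0 by simp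
next
  case (Suc l)
  let ?L = "[:- w, 1:]"
  have "?L ^ Suc e dvd qsum_deriv n l \<psi> P z"
    using Suc.prems by (intro Suc.IH) simp
  then have "?L ^ e dvd pderiv (qsum_deriv n l \<psi> P z)"
    by (rule power_dvd_pderiv)
  moreover have "?L ^ e dvd qsum_deriv n l \<psi> (pCons 0 P) z"
  proof (rule Suc.IH)
    show "degree (pCons 0 P) + 2 * l + 2 * e \<le> a + 1"
      using order_trans[OF add_right_mono[OF degree_pCons_le[of 0 P]], of "2 * l + 2 * e" "a + 1"]
        Suc.prems by simp
  qed
  ultimately have "?L ^ e dvd monom 1 1 * qsum_deriv n (Suc l) \<psi> P z"
    unfolding qsum_deriv_Suc by (intro dvd_diff dvd_mult dvd_smult)
  \<comment> \<open>The auxiliary factor q can be cancelled because it is coprime to q - w.\<close>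
  moreover have "w \<noteq> 0"
    using assms(1,2) by (auto simp: primitive_roots_unity_def power_0_left)
  then have "coprime (?L ^ e) [:- 0, 1:]"
    by (intro coprime_power_left_iff[THEN iffD2] disjI1 coprime_linear_polys)
  then have "coprime (?L ^ e) (monom 1 1)" by (simp add: monom_altdef)
  ultimately show ?case by (simp only: coprime_dvd_mult_right_iff)
qed

section \<open>From complex linear factors to cyclotomic polynomials over the integers\<close>

lemma prod_linear_power_dvd:
  assumes "finite A" "\<And>w. w \<in> A \<Longrightarrow> [:- w, 1 :: complex:] ^ e dvd p"
  shows "(\<Prod>w\<in>A. [:- w, 1:]) ^ e dvd p"
  using assms
proof (induction A rule: finite_induct)
  case (insert w A)
  have "coprime ([:- w, 1:] ^ e) ((\<Prod>w\<in>A. [:- w, 1:]) ^ e)"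
    using insert.hyps
    by (intro coprime_power_left_iff[THEN iffD2] coprime_power_right_iff[THEN iffD2] disjI1
        prod_coprime_right coprime_linear_polys) auto
  then show ?case
    using insert unfolding prod.insert[OF insert.hyps] power_mult_distrib
    by (intro divides_mult) auto
qed simp

text \<open>Division by a monic polynomial stays within integer coefficients; over the complex
  numbers \<open>B\<close> divides the remainder, whose degree is too small unless it is
  zero.\<close>

lemma monic_dvd_of_int_poly_dvd:
  fixes B p :: "int poly"
  assumes "lead_coeff B = 1" "(map_poly of_int B :: complex poly) dvd map_poly of_int p"
  shows "B dvd p"
proof -
  let ?c = "map_poly of_int :: int poly \<Rightarrow> complex poly"
  have "B \<noteq> 0" using assms(1) by auto
  obtain q r where qr: "pseudo_divmod p B = (q, r)" by fastforce
  have eq: "p = B * q + r" and r: "r = 0 \<or> degree r < degree B"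
    using pseudo_divmod[OF \<open>B \<noteq> 0\<close> qr] assms(1) by simp_all
  have "?c p = ?c B * ?c q + ?c r"
    unfolding eq map_poly_of_int_add map_poly_of_int_mult ..
  then have "?c B dvd ?c r"
    using assms(2) by (simp add: dvd_add_right_iff)
  have "r = 0"
  proof (rule ccontr)
    assume "r \<noteq> 0"
    then have "?c r \<noteq> 0" using map_poly_of_int_inject[of r 0] by auto
    then have "degree B \<le> degree r"
      using dvd_imp_degree_le[OF \<open>?c B dvd ?c r\<close>] by (simp add: degree_map_poly_of_int)
    then show False using r \<open>r \<noteq> 0\<close> by simp
  qed
  then show ?thesis using eq by simp
qed

lemma map_poly_of_int_power:
  "map_poly of_int (p ^ n) = (map_poly of_int p ^ n :: complex poly)"
  by (induction n) (simp_all add: map_poly_of_int_mult)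

lemma map_poly_of_int_sum:
  "map_poly of_int (sum f A) = (\<Sum>x\<in>A. map_poly of_int (f x) :: complex poly)"
  by (induction A rule: infinite_finite_induct) (simp_all add: map_poly_of_int_add)

lemma map_poly_of_int_pderiv_iter:
  "map_poly of_int ((pderiv ^^ l) p) = (pderiv ^^ l) (map_poly of_int p :: complex poly)"
proof (induction l)
  case (Suc l)
  have "map_poly of_int (pderiv q) = (pderiv (map_poly of_int q) :: complex poly)" for q
    by (rule poly_eqI) (simp add: coeff_map_poly coeff_pderiv)
  then show ?case using Suc by simp
qed simp

lemma poly_map_poly_of_int:
  "poly (map_poly of_int p) (of_nat m) = (of_int (poly p (int m)) :: complex)"
  by (induction p) (simp_all add: map_poly_pCons)

lemma lead_coeff_cyclotomic:
  assumes "N > 0"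
  shows "lead_coeff (cyclotomic N) = 1"
proof -
  have "lead_coeff (map_poly of_int (cyclotomic N) :: complex poly) = 1"
    unfolding of_int_cyclotomic[OF assms] by (simp add: lead_coeff_prod)
  then show ?thesis by (simp add: degree_map_poly_of_int coeff_map_poly)
qed

section \<open>The alternating signs and the final congruence\<close>

definition alternating_char :: "nat \<Rightarrow> nat \<Rightarrow> nat \<Rightarrow> complex" where
  "alternating_char c j m = (if [m = j] (mod c) then (-1) ^ ((m - j) div c) else 0)"

lemma alternating_char_add:
  assumes "c > 0" "j < c"
  shows "alternating_char c j (m + c) = - alternating_char c j m"
proof (cases "[m = j] (mod c)")
  case True
  \<comment> \<open>As \<open>j\<close> is the least residue of \<open>m\<close>, the subtraction
    \<open>m - j\<close> is not truncated.\<close>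
  then have "j \<le> m" using assms by (metis cong_def mod_less mod_less_eq_dividend)
  then have "(m + c - j) div c = Suc ((m - j) div c)"
    using assms by (simp add: Nat.diff_add_assoc2 del: Nat.add_diff_assoc2)
  then show ?thesis
    using True by (simp add: alternating_char_def cong_def)
next
  case False
  then show ?thesis by (simp add: alternating_char_def cong_def)
qed

lemma alternating_char_add_mult:
  assumes "c > 0" "j < c"
  shows "alternating_char c j (m + k * c) = (-1) ^ k * alternating_char c j m"
proof (induction k)
  case (Suc k)
  have "alternating_char c j (m + Suc k * c) = alternating_char c j ((m + k * c) + c)"
    by (simp add: algebra_simps)
  then show ?case by (simp only: alternating_char_add[OF assms] Suc.IH) simp
qed simp

theorem theorem1p2:
  fixes c k d l z j n :: nat and P :: "int poly"
  assumes "c > 0" and "k > 0" and "odd k" and "j < c"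
    and "n \<ge> (degree P + 2 * (l + d) + 1) * k * c"
  shows "cyclotomic (k * c) ^ (d + 1) dvd
    (\<Sum>m | m \<le> n \<and> [m = j] (mod c).
      (-1) ^ ((m - j) div c) * [:poly P (int m):] * (monom 1 z) ^ m
        * (pderiv ^^ l) (qbinom n m))"
proof (rule monic_dvd_of_int_poly_dvd)
  let ?S = "\<Sum>m | m \<le> n \<and> [m = j] (mod c).
      (-1) ^ ((m - j) div c) * [:poly P (int m):] * (monom 1 z) ^ m
        * (pderiv ^^ l) (qbinom n m)"
  let ?N = "k * c"
  have N: "?N > 0" using assms by simp
  show "lead_coeff (cyclotomic ?N ^ (d + 1)) = 1"
    by (simp only: lead_coeff_power lead_coeff_cyclotomic[OF N] power_one)
  have minus_one: "map_poly of_int (-1) = ([:-1:] :: complex poly)"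
    by (simp add: one_pCons map_poly_pCons)
  have "map_poly of_int ?S = (\<Sum>m | m \<le> n \<and> [m = j] (mod c).
      qterm (alternating_char c j) (map_poly of_int P) z m * (pderiv ^^ l) (cqbinom n m))"
    unfolding map_poly_of_int_sum
    unfolding map_poly_of_int_mult minus_one map_poly_of_int_power map_poly_of_int_monom
      map_poly_of_int_pderiv_iter
    by (intro sum.cong refl)
      (simp add: cqbinom_def qterm_def alternating_char_def
        poly_map_poly_of_int monom_power map_poly_pCons smult_monom poly_const_pow mult_ac)
  \<comment> \<open>Terms outside the residue class vanish, so the sum extends to all
    \<open>m \<le> n\<close>.\<close>
  also have "\<dots> = qsum_deriv n l (alternating_char c j) (map_poly of_int P) z"
    unfolding qsum_deriv_def
    by (intro sum.mono_neutral_left) (auto simp: qterm_def alternating_char_def)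
  finally have S: "map_poly of_int ?S = \<dots>" .
  have anti: "alternating_char c j (m + ?N) = - alternating_char c j m" for m
    using alternating_char_add_mult[OF assms(1,4)] assms(3) by simp
  have "[:- w, 1:] ^ (d + 1) dvd map_poly of_int ?S" if "w \<in> primitive_roots_unity ?N" for w
    unfolding S
  \<comment> \<open>With a = degree P + 2(l + d) + 1 and e = d + 1 the degree condition holds with
    equality.\<close>
  proof (rule linear_power_dvd_qsum_deriv[where \<psi> = "alternating_char c j", OF that N anti])
    show "n \<ge> (degree P + 2 * (l + d) + 1) * ?N"
      using assms(5) by (simp only: mult.assoc)
  qed (simp add: degree_map_poly_of_int)
  moreover have "finite (primitive_roots_unity ?N)"
    by (rule finite_subset[OF _ finite_unity_roots[OF N]]) (auto simp: primitive_roots_unity_def)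
  ultimately show "map_poly of_int (cyclotomic ?N ^ (d + 1)) dvd (map_poly of_int ?S :: complex poly)"
    unfolding map_poly_of_int_power of_int_cyclotomic[OF N]
    by (intro prod_linear_power_dvd)
qed

end
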